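(* Let $\mathbf{Y}\sim\mathcal{MMN}_p(\boldsymbol{\xi},\mathbf{\Omega},\boldsymbol{\delta};H)$. Then there exists a $p\times p$ matrix $\mathbf{A}_*$ such that $\mathbf{Z}^*=\mathbf{A}_*(\mathbf{Y}-\boldsymbol{\xi})\sim\mathcal{MMN}_p(\mathbf{0},\mathbf{I}_p,\boldsymbol{\delta}_{\mathbf{Z}^*};H)$ with $\boldsymbol{\delta}_{\mathbf{Z}^*}=(\delta_*,0,\dots,0)^\top$, where $\delta_*=(\boldsymbol{\delta}^\top\overline{\mathbf{\Omega}}^{-1}\boldsymbol{\delta})^{1/2}$; in particular at most one component of $\boldsymbol{\delta}_{\mathbf{Z}^*}$ is nonzero.
   Context: For $d\ge1$, $\boldsymbol{\xi}\in\mathbb{R}^d$, a $d\times d$ symmetric positive definite $\mathbf{\Omega}$, put $\boldsymbol{\omega}=\mathrm{diag}(\mathbf{\Omega}_{11}^{1/2},\dots,\mathbf{\Omega}_{dd}^{1/2})$ and $\overline{\mathbf{\Omega}}=\boldsymbol{\omega}^{-1}\mathbf{\Omega}\boldsymbol{\omega}^{-1}$; let $\boldsymbol{\delta}\in\mathbb{R}^d$ with $\overline{\mathbf{\Omega}}-\boldsymbol{\delta}\boldsymbol{\delta}^\top$ positive definite. For a real random variable $U$ with CDF $H$ and $\mathbf{Z}\sim\mathcal{N}_d(\mathbf{0},\overline{\mathbf{\Omega}}-\boldsymbol{\delta}\boldsymbol{\delta}^\top)$ independent of $U$, the law of $\boldsymbol{\xi}+\boldsymbol{\omega}(\boldsymbol{\delta}U+\mathbf{Z})$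 is denoted $\mathcal{MMN}_d(\boldsymbol{\xi},\mathbf{\Omega},\boldsymbol{\delta};H)$. *)

theory Defs
  imports "HOL-Probability.Probability"
begin

text \<open>A CDF: nondecreasing, right-continuous, limits 0 and 1.\<close>
definition is_cdf :: "(real \<Rightarrow> real) \<Rightarrow> bool" where
  "is_cdf H \<longleftrightarrow> (\<forall>x y. x \<le> y \<longrightarrow> H x \<le> H y) \<and> (\<forall>a. continuous (at_right a) H)
     \<and> (H \<longlongrightarrow> 0) at_bot \<and> (H \<longlongrightarrow> 1) at_top"

text \<open>Symmetric positive definite matrices.\<close>
definition sym_posdef :: "real^'n^'n \<Rightarrow> bool" where
  "sym_posdef S \<longleftrightarrow> transpose S = S \<and> (\<forall>x. x \<noteq> 0 \<longrightarrow> x \<bullet> (S *v x) > 0)"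

definition outer :: "real^'n \<Rightarrow> real^'n^'n" where
  "outer d = (\<chi> i j. d$i * d$j)"

text \<open>omega = diag(Omega_11^(1/2), ..., Omega_dd^(1/2)) and the correlation matrix Omega bar.\<close>
definition omega_diag :: "real^'n^'n \<Rightarrow> real^'n^'n" where
  "omega_diag S = (\<chi> i j. if i = j then sqrt (S$i$i) else 0)"

definition Omega_bar :: "real^'n^'n \<Rightarrow> real^'n^'n" where
  "Omega_bar S = matrix_inv (omega_diag S) ** S ** matrix_inv (omega_diag S)"

text \<open>Standard normal vector (iid N(0,1) coordinates) and centred Gaussian N_d(0,Sigma),
  realised as L W with L L^T = Sigma (the law does not depend on the choice of L).\<close>
definition gaussian :: "real^'n^'n \<Rightarrow> (real^'n) measure" where
  "gaussian S = distr (distr (PiM UNIV (\<lambda>_::'n. density lborel std_normal_density)) borel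
      (\<lambda>w. \<chi> i. w i)) borel (\<lambda>w. (SOME L. L ** transpose L = S) *v w)"

text \<open>MMN_d(xi, Omega, delta; H): law of xi + omega (delta U + Z), U ~ H independent of
  Z ~ N_d(0, Omega bar - delta delta^T).\<close>
definition MMN :: "real^'n \<Rightarrow> real^'n^'n \<Rightarrow> real^'n \<Rightarrow> (real \<Rightarrow> real) \<Rightarrow> (real^'n) measure" where
  "MMN xi S d H = distr (interval_measure H \<Otimes>\<^sub>M gaussian (Omega_bar S - outer d)) borel
      (\<lambda>(u, z). xi + omega_diag S *v (u *\<^sub>R d + z))"

end

theory Submission
  imports Defs
begin

(* Write Y - xi = omega (delta U + Z). If B whitens Omega bar, i.e. B Omega_bar B^T = I, then B Z is
   centred Gaussian with covariance B (Omega_bar - delta delta^T) B^T = I - (B delta) (B delta)^T, so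
   A = B omega^-1 maps Y - xi to U (B delta) + B Z, an MMN vector with location 0, scale I and
   skewness vector B delta. Such a B is the inverse of a Cholesky factor C of Omega bar followed by a
   rotation: since |C^-1 delta|^2 = delta^T Omega_bar^-1 delta = delta_*^2, the rotation can send
   C^-1 delta to delta_* e_1. That a Gaussian law depends only on its covariance, and not on the
   square root used to build it, comes from the rotation invariance of the standard Gaussian density. *)

section \<open>Matrix algebra and the Cholesky factorization\<close>

lemma transpose_eq_self_iff: "transpose X = X \<longleftrightarrow> (\<forall>i j. X$i$j = X$j$i)"
  by (auto simp: transpose_def vec_eq_iff)

lemma outer_mult_vector: "outer c *v x = (c \<bullet> x) *\<^sub>R c"
  by (simp add: outer_def vec_eq_iff matrix_vector_mult_def inner_vec_def sum_distrib_left mult_ac)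

lemma matrix_outer_transpose: "A ** outer d ** transpose A = outer (A *v d)"
  by (simp add: vec_eq_iff outer_def matrix_matrix_mult_def transpose_def matrix_vector_mult_def
      sum_distrib_left sum_distrib_right mult_ac)

lemma matrix_diff_ldistrib: "(A::real^'n^'m) ** (B - C) = A ** B - A ** C"
  by (simp add: vec_eq_iff matrix_matrix_mult_def sum_subtractf algebra_simps)

lemma matrix_diff_rdistrib: "((B::real^'n^'m) - C) ** (A::real^'k^'n) = B ** A - C ** A"
  by (simp add: vec_eq_iff matrix_matrix_mult_def sum_subtractf algebra_simps)

lemma matrix_inv_inverse:
  fixes A :: "real^'n^'n"
  assumes "invertible A"
  shows "A ** matrix_inv A = mat 1" and "matrix_inv A ** A = mat 1"
proof -
  have "\<exists>A'. A ** A' = mat 1 \<and> A' ** A = mat 1"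
    using assms invertible_def by blast
  then have "A ** matrix_inv A = mat 1 \<and> matrix_inv A ** A = mat 1"
    unfolding matrix_inv_def by (rule someI_ex)
  then show "A ** matrix_inv A = mat 1" "matrix_inv A ** A = mat 1"
    by auto
qed

lemma matrix_inv_unique:
  fixes A B :: "real^'n^'n"
  assumes "A ** B = mat 1"
  shows "matrix_inv A = B"
proof -
  have "invertible A"
    using assms invertible_right_inverse by blast
  then have "matrix_inv A = matrix_inv A ** (A ** B)"
    using assms by simp
  also have "\<dots> = B"
    by (simp add: matrix_mul_assoc matrix_inv_inverse(2)[OF \<open>invertible A\<close>])
  finally show ?thesis .
qed

lemma omega_diag_mat_1: "omega_diag (mat 1 :: real^'n^'n) = mat 1"
  by (simp add: omega_diag_def mat_def vec_eq_iff)

lemma Omega_bar_mat_1: "Omega_bar (mat 1 :: real^'n^'n) = mat 1"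
  using matrix_inv_unique[of "mat 1 :: real^'n^'n" "mat 1"]
  by (simp add: Omega_bar_def omega_diag_mat_1)

definition posdef_on :: "'n set \<Rightarrow> real^'n^'n \<Rightarrow> bool" where
  "posdef_on I X \<longleftrightarrow> (\<forall>x. x \<noteq> 0 \<longrightarrow> (\<forall>i. i \<notin> I \<longrightarrow> x$i = 0) \<longrightarrow> x \<bullet> (X *v x) > 0)"

lemma sym_posdef_iff: "sym_posdef X \<longleftrightarrow> transpose X = X \<and> posdef_on UNIV X"
  by (simp add: sym_posdef_def posdef_on_def)

lemma posdef_on_diagonal_pos:
  assumes "posdef_on I X" "k \<in> I"
  shows "X$k$k > 0"
proof -
  have "axis k 1 \<bullet> (X *v axis k 1) > 0"
    using assms by (auto simp: posdef_on_def axis_def vec_eq_iff)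
  then show ?thesis
    by (simp add: inner_axis' matrix_vector_mult_basis column_def)
qed

lemma posdef_on_Schur_complement:
  fixes X :: "real^'n^'n"
  assumes sym: "transpose X = X" and pd: "posdef_on (insert k I) X" and "k \<notin> I"
  shows "posdef_on I (X - (1 / X$k$k) *\<^sub>R outer (column k X))"
  unfolding posdef_on_def
proof (intro allI impI)
  fix x :: "real^'n"
  assume "x \<noteq> 0" and supp: "\<forall>i. i \<notin> I \<longrightarrow> x$i = 0"
  define a where "a = X$k$k"
  define c where "c = column k X"
  \<comment> \<open>The Schur complement's quadratic form at x is that of X at y.\<close>
  define y where "y = x - ((c \<bullet> x) / a) *\<^sub>R axis k 1"
  have "a > 0"
    using posdef_on_diagonal_pos[OF pd] by (simp add: a_def)
  have "x$k = 0"
    using supp \<open>k \<notin> I\<close> by blast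
  then have "y$i = x$i" if "i \<noteq> k" for i
    using that by (simp add: y_def axis_def)
  then have "y \<noteq> 0"
    using \<open>x \<noteq> 0\<close> \<open>x$k = 0\<close> by (metis vec_eq_iff zero_index)
  moreover have "\<forall>i. i \<notin> insert k I \<longrightarrow> y$i = 0"
    using supp by (simp add: y_def axis_def)
  ultimately have pos: "y \<bullet> (X *v y) > 0"
    using pd by (simp add: posdef_on_def)
  have "(X *v x)$k = c \<bullet> x"
    using sym by (simp add: matrix_vector_mult_def c_def column_def inner_vec_def
        transpose_eq_self_iff mult.commute)
  moreover have "X *v axis k 1 = c" "c$k = a"
    by (simp_all add: matrix_vector_mult_basis c_def a_def column_def)
  ultimately have "y \<bullet> (X *v y) = x \<bullet> (X *v x) - (c \<bullet> x)^2 / a"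
    using \<open>a > 0\<close>
    by (simp add: y_def matrix_vector_mult_diff_distrib matrix_vector_mult_scaleR
        inner_diff_left inner_diff_right inner_axis' inner_commute[of x c] power2_eq_square field_simps)
  also have "\<dots> = x \<bullet> ((X - (1 / a) *\<^sub>R outer c) *v x)"
    by (simp add: matrix_vector_mult_diff_rdistrib scaleR_matrix_vector_assoc[symmetric] outer_mult_vector
        inner_diff_right inner_commute[of x c] power2_eq_square)
  finally show "x \<bullet> ((X - (1 / X$k$k) *\<^sub>R outer (column k X)) *v x) > 0"
    using pos by (simp add: a_def c_def)
qed

lemma cholesky_on:
  fixes X :: "real^'n^'n"
  assumes "transpose X = X" and "posdef_on I X"
  shows "\<exists>L::real^'n^'n. (\<forall>i\<in>I. \<forall>j\<in>I. (\<Sum>m\<in>I. L$i$m * L$j$m) = X$i$j) \<and>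
           (\<forall>i m. m \<in> I \<longrightarrow> i \<notin> I \<longrightarrow> L$i$m = 0)"
  using finite[of I] assms
proof (induction I arbitrary: X rule: finite_induct)
  case empty
  show ?case by auto
next
  case (insert k I)
  define a where "a = X$k$k"
  define C where "C = X - (1 / a) *\<^sub>R outer (column k X)"
  have sym: "X$i$j = X$j$i" for i j
    using insert.prems(1) by (simp add: transpose_eq_self_iff)
  have "a > 0"
    using posdef_on_diagonal_pos[OF insert.prems(2)] by (simp add: a_def)
  have "transpose C = C"
    using sym by (simp add: C_def transpose_eq_self_iff outer_def column_def mult.commute)
  moreover have "posdef_on I C"
    using posdef_on_Schur_complement[OF insert.prems insert.hyps(2)] by (simp add: C_def a_def)
  ultimately obtain L' where L': "\<forall>i\<in>I. \<forall>j\<in>I. (\<Sum>m\<in>I. L'$i$m * L'$j$m) = C$i$j"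
    and L'_supp: "\<forall>i m. m \<in> I \<longrightarrow> i \<notin> I \<longrightarrow> L'$i$m = 0"
    using insert.IH by blast
  \<comment> \<open>Row and column k of the Schur complement vanish, matching the zero row k of L'.\<close>
  have "C$k$j = 0" "C$j$k = 0" for j
    using \<open>a > 0\<close> sym by (simp_all add: C_def outer_def column_def a_def)
  then have L'_C: "(\<Sum>m\<in>I. L'$i$m * L'$j$m) = C$i$j" if "i \<in> insert k I" "j \<in> insert k I" for i j
    using that L' L'_supp insert.hyps(2) by auto
  define L where "L = (\<chi> i m. if m = k then (if i \<in> insert k I then X$i$k / sqrt a else 0) else L'$i$m)"
  have "(\<Sum>m\<in>insert k I. L$i$m * L$j$m) = X$i$j" if "i \<in> insert k I" "j \<in> insert k I" for i j
  proof -
    have "(\<Sum>m\<in>I. L$i$m * L$j$m) = (\<Sum>m\<in>I. L'$i$m * L'$j$m)"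
      using insert.hyps(2) by (intro sum.cong) (auto simp: L_def)
    then have "(\<Sum>m\<in>insert k I. L$i$m * L$j$m) = X$i$k * X$j$k / a + C$i$j"
      using insert.hyps that \<open>a > 0\<close> L'_C[OF that] by (simp add: L_def real_sqrt_mult[symmetric])
    also have "\<dots> = X$i$j"
      by (simp add: C_def outer_def column_def)
    finally show ?thesis .
  qed
  moreover have "\<forall>i m. m \<in> insert k I \<longrightarrow> i \<notin> insert k I \<longrightarrow> L$i$m = 0"
    using L'_supp by (auto simp: L_def)
  ultimately show ?case by blast
qed

lemma sym_posdef_invertible:
  assumes "sym_posdef (X::real^'n^'n)"
  shows "invertible X"
proof -
  have "\<forall>x. X *v x = 0 \<longrightarrow> x = 0"
    using assms by (metis inner_zero_right less_irrefl sym_posdef_def)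
  then show ?thesis
    using matrix_left_invertible_ker invertible_left_inverse by blast
qed

lemma cholesky:
  fixes X :: "real^'n^'n"
  assumes "sym_posdef X"
  obtains L :: "real^'n^'n" where "L ** transpose L = X" and "invertible L"
proof -
  obtain L :: "real^'n^'n" where "\<forall>i j. (\<Sum>m\<in>UNIV. L$i$m * L$j$m) = X$i$j"
    using cholesky_on[of X UNIV] assms by (auto simp: sym_posdef_iff)
  then have LX: "L ** transpose L = X"
    by (simp add: vec_eq_iff matrix_matrix_mult_def transpose_def)
  have "det L * det L \<noteq> 0"
    using sym_posdef_invertible[OF assms] arg_cong[OF LX, of det]
    by (simp add: det_mul invertible_det_nz)
  then have "invertible L"
    by (simp add: invertible_det_nz)
  with LX show ?thesis
    by (rule that)
qed

lemma sym_posdef_add_outer: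
  assumes "sym_posdef X"
  shows "sym_posdef (X + outer d)"
proof -
  have "x \<bullet> ((X + outer d) *v x) = x \<bullet> (X *v x) + (d \<bullet> x)^2" for x
    by (simp add: matrix_vector_mult_add_rdistrib outer_mult_vector inner_add_right
        inner_commute[of x d] power2_eq_square)
  moreover have "transpose (X + outer d) = X + outer d"
    using assms by (simp add: sym_posdef_def transpose_eq_self_iff outer_def mult.commute)
  ultimately show ?thesis
    using assms by (simp add: sym_posdef_def add_pos_nonneg)
qed

lemma invertible_omega_diag:
  assumes "sym_posdef S"
  shows "invertible (omega_diag S)"
proof -
  have "S$i$i \<noteq> 0" for i
    using assms posdef_on_diagonal_pos[of UNIV S i] by (auto simp: sym_posdef_iff)
  then have "det (omega_diag S) \<noteq> 0"
    by (subst det_diagonal) (auto simp: omega_diag_def)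
  then show ?thesis
    by (simp add: invertible_det_nz)
qed

lemma whitening:
  fixes X :: "real^'n^'n"
  assumes "sym_posdef X"
  obtains B :: "real^'n^'n" where "B ** X ** transpose B = mat 1"
    and "B *v d = axis k (sqrt (d \<bullet> (matrix_inv X *v d)))"
proof -
  obtain C :: "real^'n^'n" where CX: "C ** transpose C = X" and "invertible C"
    using cholesky[OF assms] .
  define Ci where "Ci = matrix_inv C"
  have Ci: "C ** Ci = mat 1" "Ci ** C = mat 1"
    using matrix_inv_inverse[OF \<open>invertible C\<close>] by (simp_all add: Ci_def)
  then have Ci_transpose: "transpose C ** transpose Ci = mat 1"
    by (metis matrix_transpose_mul transpose_mat)
  have "X ** (transpose Ci ** Ci) = mat 1"
    by (metis CX Ci(1) Ci_transpose matrix_mul_assoc matrix_mul_rid)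
  then have "d \<bullet> (matrix_inv X *v d) = (Ci *v d) \<bullet> (Ci *v d)"
    by (simp add: matrix_inv_unique matrix_vector_mul_assoc[symmetric] dot_lmul_matrix[symmetric]
        inner_commute)
  then have "norm (Ci *v d) = norm (axis k (sqrt (d \<bullet> (matrix_inv X *v d))))"
    by (simp add: norm_eq_sqrt_inner inner_axis_axis)
  then obtain f where f: "orthogonal_transformation f"
    and f_d: "f (Ci *v d) = axis k (sqrt (d \<bullet> (matrix_inv X *v d)))"
    using orthogonal_transformation_exists by blast
  define R where "R = matrix f"
  have "f = (*v) R"
    using f by (simp add: R_def orthogonal_transformation_linear)
  have "R ** transpose R = mat 1"
    using f by (simp add: R_def orthogonal_transformation_matrix orthogonal_matrix_def)
  have "(R ** Ci) ** X ** transpose (R ** Ci) = R ** (Ci ** C) ** (transpose C ** transpose Ci) ** transpose R"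
    by (simp add: CX[symmetric] matrix_transpose_mul matrix_mul_assoc)
  also have "\<dots> = mat 1"
    by (simp add: Ci Ci_transpose \<open>R ** transpose R = mat 1\<close>)
  finally show ?thesis
    using that f_d \<open>f = (*v) R\<close> by (simp add: matrix_vector_mul_assoc[symmetric])
qed

section \<open>The standard Gaussian vector\<close>

lemma borel_measurable_matrix_vector_mult [measurable]:
  "(\<lambda>x. (A::real^'n^'m) *v x) \<in> borel_measurable borel"
  by (intro borel_measurable_continuous_onI matrix_vector_mult_linear_continuous_on)

lemma vec_lambda_measurable [measurable]:
  "vec_lambda \<in> measurable (PiM UNIV (\<lambda>_::'n::finite. borel)) (borel :: (real^'n) measure)"
proof (subst borel_measurable_euclidean_space, intro ballI)
  fix b :: "real^'n"
  assume "b \<in> Basis"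
  then obtain i where "b = axis i 1"
    by (auto simp: Basis_vec_def)
  moreover have "(\<lambda>x. x i) \<in> borel_measurable (PiM UNIV (\<lambda>_::'n. (borel::real measure)))"
    by (rule measurable_component_singleton) simp
  ultimately show "(\<lambda>x. vec_lambda x \<bullet> b) \<in> borel_measurable (PiM UNIV (\<lambda>_::'n. borel))"
    by (simp add: inner_axis)
qed

lemma vec_nth_PiM_measurable [measurable]:
  "(\<lambda>(x::real^'n) i. x$i) \<in> measurable borel (PiM UNIV (\<lambda>_::'n. borel))"
  by (rule measurable_PiM_single') auto

lemma nn_integral_lborel_prod_vec:
  fixes f :: "'n::finite \<Rightarrow> real \<Rightarrow> ennreal"
  assumes [measurable]: "\<And>i. f i \<in> borel_measurable borel"
  shows "(\<integral>\<^sup>+x. (\<Prod>i\<in>UNIV. f i (x$i)) \<partial>(lborel :: (real^'n) measure)) = (\<Prod>i\<in>UNIV. \<integral>\<^sup>+t. f i t \<partial>lborel)"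
proof -
  define g where "g b = f (SOME i. b = axis i 1)" for b :: "real^'n"
  have g_axis: "g (axis i 1) = f i" for i
    by (simp add: g_def axis_eq_axis)
  have prod_Basis: "(\<Prod>b\<in>Basis. h b) = (\<Prod>i\<in>UNIV. h (axis i 1))" for h :: "real^'n \<Rightarrow> ennreal"
  proof -
    have Basis_eq: "(Basis :: (real^'n) set) = range (\<lambda>i. axis i 1)"
      by (auto simp: Basis_vec_def)
    have "inj (\<lambda>i::'n. axis i (1::real))"
      by (auto simp: inj_def axis_eq_axis)
    then show ?thesis
      unfolding Basis_eq by (simp add: prod.reindex)
  qed
  have "(\<integral>\<^sup>+x. (\<Prod>i\<in>UNIV. f i (x$i)) \<partial>lborel) = (\<integral>\<^sup>+x. (\<Prod>b\<in>Basis. g b (x \<bullet> b)) \<partial>lborel)"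
    by (simp add: prod_Basis g_axis inner_axis)
  also have "\<dots> = (\<Prod>b\<in>Basis. \<integral>\<^sup>+t. g b t \<partial>lborel)"
    by (rule nn_integral_lborel_prod) (simp_all add: g_def)
  also have "\<dots> = (\<Prod>i\<in>UNIV. \<integral>\<^sup>+t. f i t \<partial>lborel)"
    by (simp add: prod_Basis g_axis)
  finally show ?thesis .
qed

lemma emeasure_density_lborel_prod_vec:
  fixes f :: "'n::finite \<Rightarrow> real \<Rightarrow> ennreal"
  assumes [measurable]: "\<And>i. f i \<in> borel_measurable borel" "\<And>i. A i \<in> sets borel"
  shows "emeasure (density lborel (\<lambda>x::real^'n. \<Prod>i\<in>UNIV. f i (x$i))) {x. \<forall>i. x$i \<in> A i}
    = (\<Prod>i\<in>UNIV. emeasure (density lborel (f i)) (A i))"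
proof -
  have "{x::real^'n. \<forall>i. x$i \<in> A i} = (\<lambda>x i. x$i) -` PiE UNIV A"
    by (auto simp: PiE_def extensional_def)
  then have [measurable]: "{x::real^'n. \<forall>i. x$i \<in> A i} \<in> sets borel"
    using measurable_sets[OF vec_nth_PiM_measurable sets_PiM_I_finite[of UNIV A]] by simp
  have "indicator {x. \<forall>i. x$i \<in> A i} x = (\<Prod>i\<in>UNIV. indicator (A i) (x$i) :: ennreal)" for x :: "real^'n"
    by (auto simp: indicator_def prod_zero)
  then have "emeasure (density lborel (\<lambda>x::real^'n. \<Prod>i\<in>UNIV. f i (x$i))) {x. \<forall>i. x$i \<in> A i}
      = (\<integral>\<^sup>+x. (\<Prod>i\<in>UNIV. f i (x$i) * indicator (A i) (x$i)) \<partial>lborel)"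
    by (simp add: emeasure_density prod.distrib)
  also have "\<dots> = (\<Prod>i\<in>UNIV. emeasure (density lborel (f i)) (A i))"
    by (subst nn_integral_lborel_prod_vec) (simp_all add: emeasure_density)
  finally show ?thesis .
qed

lemma PiM_density_lborel_vec:
  fixes f :: "'n::finite \<Rightarrow> real \<Rightarrow> ennreal"
  assumes [measurable]: "\<And>i. f i \<in> borel_measurable borel"
    and "\<And>i. sigma_finite_measure (density lborel (f i))"
  shows "distr (PiM UNIV (\<lambda>i. density lborel (f i))) borel vec_lambda
    = density lborel (\<lambda>x::real^'n. \<Prod>i\<in>UNIV. f i (x$i))"
proof -
  interpret product_sigma_finite "\<lambda>i. density lborel (f i)"
    using assms(2) by (simp add: product_sigma_finite_def)
  have "PiM UNIV (\<lambda>i. density lborel (f i))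
      = distr (density lborel (\<lambda>x::real^'n. \<Prod>i\<in>UNIV. f i (x$i))) (PiM UNIV (\<lambda>_. borel)) (\<lambda>x i. x$i)"
  proof (rule PiM_eqI[symmetric])
    show "finite (UNIV :: 'n set)"
      by simp
    show "sets (distr (density lborel (\<lambda>x::real^'n. \<Prod>i\<in>UNIV. f i (x$i))) (PiM UNIV (\<lambda>_. borel)) (\<lambda>x i. x$i))
      = sets (PiM UNIV (\<lambda>i. density lborel (f i)))"
      by (simp cong: sets_PiM_cong)
    fix A assume "\<And>i. i \<in> UNIV \<Longrightarrow> A i \<in> sets (density lborel (f i))"
    then have [measurable]: "A i \<in> sets borel" for i
      by simp
    have "(\<lambda>(x::real^'n) i. x$i) -` PiE UNIV A \<inter> space lborel = {x. \<forall>i. x$i \<in> A i}"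
      by (auto simp: PiE_def extensional_def)
    then show "emeasure (distr (density lborel (\<lambda>x::real^'n. \<Prod>i\<in>UNIV. f i (x$i))) (PiM UNIV (\<lambda>_. borel)) (\<lambda>x i. x$i)) (PiE UNIV A)
        = (\<Prod>i\<in>UNIV. emeasure (density lborel (f i)) (A i))"
      by (simp add: emeasure_distr sets_PiM_I_finite emeasure_density_lborel_prod_vec)
  qed
  also have "distr \<dots> borel vec_lambda
      = distr (density lborel (\<lambda>x::real^'n. \<Prod>i\<in>UNIV. f i (x$i))) borel (vec_lambda \<circ> (\<lambda>x i. x$i))"
    by (rule distr_distr) (simp_all add: vec_lambda_measurable vec_nth_PiM_measurable)
  also have "\<dots> = density lborel (\<lambda>x::real^'n. \<Prod>i\<in>UNIV. f i (x$i))"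
    by (simp add: comp_def distr_id2)
  finally show ?thesis .
qed

definition std_gaussian_density :: "real^'n \<Rightarrow> real" where
  "std_gaussian_density x = (\<Prod>i\<in>UNIV. std_normal_density (x$i))"

definition std_gaussian :: "(real^'n) measure" where
  "std_gaussian = density lborel std_gaussian_density"

lemma std_gaussian_eq_distr_PiM:
  "std_gaussian = distr (PiM UNIV (\<lambda>_::'n::finite. std_normal_distribution)) borel vec_lambda"
proof -
  have "prob_space std_normal_distribution"
    by (simp add: prob_space_normal_density)
  then show ?thesis
    using PiM_density_lborel_vec[of "\<lambda>(_::'n) t. ennreal (std_normal_density t)"]
    by (simp add: std_gaussian_def std_gaussian_density_def prod_ennreal prob_space_imp_sigma_finite)
qed

lemma prob_space_std_gaussian: "prob_space std_gaussian"
  unfolding std_gaussian_eq_distr_PiM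
  by (intro prob_space.prob_space_distr prob_space_PiM vec_lambda_measurable)
    (simp_all add: prob_space_normal_density cong: sets_PiM_cong)

lemma gaussian_eq_distr_std_gaussian:
  "gaussian S = distr std_gaussian borel (\<lambda>w. (SOME L::real^'n^'n. L ** transpose L = S) *v w)"
  by (simp add: gaussian_def std_gaussian_eq_distr_PiM)

lemma std_gaussian_density_eq:
  "std_gaussian_density (x::real^'n) = (1 / sqrt (2*pi))^CARD('n) * exp (- (x \<bullet> x) / 2)"
proof -
  have "std_gaussian_density x = (\<Prod>i\<in>UNIV. (1 / sqrt (2*pi)) * exp (- ((x$i)^2) / 2))"
    by (simp add: std_gaussian_density_def std_normal_density_def)
  also have "\<dots> = (1 / sqrt (2*pi))^CARD('n) * exp (\<Sum>i\<in>UNIV. - ((x$i)^2) / 2)"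
    by (simp only: prod.distrib prod_constant) (simp add: exp_sum)
  also have "(\<Sum>i\<in>UNIV. - ((x$i)^2) / 2) = - (x \<bullet> x) / 2"
    by (simp add: inner_vec_def sum_divide_distrib[symmetric] sum_negf power2_eq_square)
  finally show ?thesis .
qed

lemma orthogonal_matrix_inner:
  assumes "orthogonal_matrix (Q::real^'n^'n)"
  shows "(Q *v x) \<bullet> (Q *v y) = x \<bullet> y"
  using assms
  by (metis dot_lmul_matrix matrix_vector_mul_assoc matrix_vector_mul_lid orthogonal_matrix
      transpose_matrix_vector)

lemma distr_lborel_orthogonal:
  fixes Q :: "real^'n::{finite,wellorder}^'n::{finite,wellorder}"
  assumes Q: "orthogonal_matrix Q"
  shows "distr lborel borel (\<lambda>x. Q *v x) = lborel"
proof (rule lborel_eqI[symmetric])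
  fix l u :: "real^'n::{finite,wellorder}"
  assume "\<And>b. b \<in> Basis \<Longrightarrow> l \<bullet> b \<le> u \<bullet> b"
  define T where "T = (\<lambda>x. transpose Q *v x)"
  have "Q *v T y = y" "T (Q *v y) = y" for y
    using Q by (simp_all only: T_def matrix_vector_mul_assoc orthogonal_matrix_def matrix_vector_mul_lid)
  then have preimage: "(\<lambda>x. Q *v x) -` box l u = T ` box l u"
    by (auto intro: image_eqI[of _ _ "Q *v _"])
  have "orthogonal_transformation T"
    using Q by (simp del: transpose_matrix_vector add: T_def orthogonal_transformation_matrix)
  have emeasure_lebesgue: "emeasure lebesgue A = emeasure lborel A" if "A \<in> sets borel" for A :: "(real^'n::{finite,wellorder}) set"
    using that by simp
  have borel: "(\<lambda>x. Q *v x) -` box l u \<in> sets borel"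
    using measurable_sets_borel[OF borel_measurable_matrix_vector_mult[of Q], of "box l u"] by simp
  have "emeasure (distr lborel borel (\<lambda>x. Q *v x)) (box l u) = emeasure lborel ((\<lambda>x. Q *v x) -` box l u)"
    by (simp add: emeasure_distr)
  also have "\<dots> = emeasure lebesgue (T ` box l u)"
    using emeasure_lebesgue[OF borel] by (simp only: preimage)
  also have "\<dots> = emeasure lebesgue (box l u)"
    using measurable_orthogonal_image[OF \<open>orthogonal_transformation T\<close> lmeasurable_box]
      measure_orthogonal_image[OF \<open>orthogonal_transformation T\<close> lmeasurable_box]
    by (simp add: emeasure_eq_measure2)
  also have "\<dots> = (\<Prod>b\<in>Basis. (u - l) \<bullet> b)"
    using \<open>\<And>b. b \<in> Basis \<Longrightarrow> l \<bullet> b \<le> u \<bullet> b\<close> by (simp add: emeasure_lebesgue)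
  finally show "emeasure (distr lborel borel (\<lambda>x. Q *v x)) (box l u) = (\<Prod>b\<in>Basis. (u - l) \<bullet> b)" .
qed simp

lemma distr_std_gaussian_orthogonal:
  fixes Q :: "real^'n::{finite,wellorder}^'n::{finite,wellorder}"
  assumes "orthogonal_matrix Q"
  shows "distr std_gaussian borel (\<lambda>x. Q *v x) = std_gaussian"
proof -
  have "std_gaussian = density (distr lborel borel (\<lambda>x. Q *v x)) std_gaussian_density"
    by (simp add: std_gaussian_def distr_lborel_orthogonal[OF assms])
  also have "\<dots> = distr (density lborel (\<lambda>x. std_gaussian_density (Q *v x))) borel (\<lambda>x. Q *v x)"
    by (rule density_distr) (simp_all add: std_gaussian_density_def)
  also have "\<dots> = distr std_gaussian borel (\<lambda>x. Q *v x)"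
    using orthogonal_matrix_inner[OF assms] by (simp add: std_gaussian_def std_gaussian_density_eq)
  finally show ?thesis ..
qed

lemma same_gram_orthogonal_factor:
  fixes L L' :: "real^'n^'n"
  assumes gram: "L' ** transpose L' = L ** transpose L" and "invertible L"
  obtains Q where "orthogonal_matrix Q" and "L = L' ** Q"
proof -
  have "det L' * det L' = det L * det L"
    using arg_cong[OF gram, of det] by (simp add: det_mul)
  then have "invertible L'"
    using \<open>invertible L\<close> by (auto simp: invertible_det_nz)
  define Q where "Q = matrix_inv L' ** L"
  have "Q ** transpose Q = matrix_inv L' ** (L' ** transpose L') ** transpose (matrix_inv L')"
    by (simp add: Q_def gram matrix_transpose_mul matrix_mul_assoc)
  also have "\<dots> = (matrix_inv L' ** L') ** transpose (matrix_inv L' ** L')"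
    by (simp add: matrix_transpose_mul matrix_mul_assoc)
  also have "\<dots> = mat 1"
    by (simp add: matrix_inv_inverse[OF \<open>invertible L'\<close>])
  finally have "orthogonal_matrix Q"
    using matrix_left_right_inverse orthogonal_matrix_def by blast
  moreover have "L = L' ** Q"
    by (simp add: Q_def matrix_mul_assoc matrix_inv_inverse[OF \<open>invertible L'\<close>])
  ultimately show ?thesis
    using that by blast
qed

lemma gaussian_factor:
  fixes L :: "real^'n::{finite,wellorder}^'n::{finite,wellorder}"
  assumes "invertible L"
  shows "gaussian (L ** transpose L) = distr std_gaussian borel (\<lambda>w. L *v w)"
proof -
  define L' where "L' = (SOME L'::real^'n::{finite,wellorder}^'n::{finite,wellorder}. L' ** transpose L' = L ** transpose L)"
  have "L' ** transpose L' = L ** transpose L"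
    unfolding L'_def by (rule someI[of _ L]) simp
  then obtain Q where "orthogonal_matrix Q" and "L = L' ** Q"
    using same_gram_orthogonal_factor assms by blast
  have "distr std_gaussian borel (\<lambda>w. L *v w) = distr std_gaussian borel ((\<lambda>w. L' *v w) \<circ> (\<lambda>w. Q *v w))"
    by (simp add: comp_def matrix_vector_mul_assoc \<open>L = L' ** Q\<close>)
  also have "\<dots> = distr (distr std_gaussian borel (\<lambda>w. Q *v w)) borel (\<lambda>w. L' *v w)"
    by (rule distr_distr[symmetric]) (simp_all add: std_gaussian_def)
  also have "\<dots> = gaussian (L ** transpose L)"
    by (simp add: distr_std_gaussian_orthogonal[OF \<open>orthogonal_matrix Q\<close>]
        gaussian_eq_distr_std_gaussian L'_def)
  finally show ?thesis ..
qed

lemma gaussian_linear_image: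
  fixes X B :: "real^'n::{finite,wellorder}^'n::{finite,wellorder}"
  assumes "sym_posdef X" and "invertible B"
  shows "distr (gaussian X) borel (\<lambda>z. B *v z) = gaussian (B ** X ** transpose B)"
proof -
  obtain L :: "real^'n::{finite,wellorder}^'n::{finite,wellorder}" where LX: "L ** transpose L = X" and "invertible L"
    using cholesky[OF assms(1)] .
  then have "invertible (B ** L)"
    using assms(2) invertible_mult by blast
  have "distr (gaussian X) borel (\<lambda>z. B *v z) = distr (distr std_gaussian borel (\<lambda>w. L *v w)) borel (\<lambda>z. B *v z)"
    using gaussian_factor[OF \<open>invertible L\<close>] LX by simp
  also have "\<dots> = distr std_gaussian borel (\<lambda>w. (B ** L) *v w)"
    by (subst distr_distr) (simp_all add: std_gaussian_def comp_def matrix_vector_mul_assoc)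
  also have "\<dots> = gaussian ((B ** L) ** transpose (B ** L))"
    using gaussian_factor[OF \<open>invertible (B ** L)\<close>] ..
  also have "(B ** L) ** transpose (B ** L) = B ** X ** transpose B"
    by (simp add: LX[symmetric] matrix_transpose_mul matrix_mul_assoc)
  finally show ?thesis .
qed

lemma prob_space_gaussian: "prob_space (gaussian X)"
  unfolding gaussian_eq_distr_std_gaussian
  by (rule prob_space.prob_space_distr[OF prob_space_std_gaussian]) (simp add: std_gaussian_def)

lemma sets_gaussian [simp, measurable_cong]: "sets (gaussian X) = sets borel"
  by (simp add: gaussian_def)

section \<open>Linear images of MMN laws\<close>

lemma MMN_mat_1:
  "MMN 0 (mat 1) e H = distr (interval_measure H \<Otimes>\<^sub>M gaussian (mat 1 - outer e)) borel (\<lambda>(u, z). u *\<^sub>R e + z)"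
  by (simp add: MMN_def omega_diag_mat_1 Omega_bar_mat_1)

lemma distr_pair_gaussian_linear:
  fixes X B :: "real^'n::{finite,wellorder}^'n::{finite,wellorder}"
  assumes [measurable_cong]: "sets N = sets borel"
    and "sym_posdef X" and "invertible B"
  shows "distr (N \<Otimes>\<^sub>M gaussian X) borel (\<lambda>(u, z). B *v (u *\<^sub>R d + z))
    = distr (N \<Otimes>\<^sub>M gaussian (B ** X ** transpose B)) borel (\<lambda>(u, z). u *\<^sub>R (B *v d) + z)"
proof -
  have "sigma_finite_measure (distr (gaussian X) borel (\<lambda>z. B *v z))"
    by (simp add: gaussian_linear_image assms prob_space_gaussian prob_space_imp_sigma_finite)
  then have "distr N borel (\<lambda>u. u) \<Otimes>\<^sub>M distr (gaussian X) borel (\<lambda>z. B *v z)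
      = distr (N \<Otimes>\<^sub>M gaussian X) (borel \<Otimes>\<^sub>M borel) (\<lambda>(u, z). (u, B *v z))"
    by (intro pair_measure_distr) simp_all
  then have "N \<Otimes>\<^sub>M gaussian (B ** X ** transpose B)
      = distr (N \<Otimes>\<^sub>M gaussian X) (borel \<Otimes>\<^sub>M borel) (\<lambda>(u, z). (u, B *v z))"
    using distr_id2[OF assms(1)[symmetric]] by (simp add: gaussian_linear_image assms)
  then have "distr (N \<Otimes>\<^sub>M gaussian (B ** X ** transpose B)) borel (\<lambda>(u, z). u *\<^sub>R (B *v d) + z)
      = distr (N \<Otimes>\<^sub>M gaussian X) borel ((\<lambda>(u, z). u *\<^sub>R (B *v d) + z) \<circ> (\<lambda>(u, z). (u, B *v z)))"
    by (simp add: distr_distr)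
  also have "(\<lambda>(u, z). u *\<^sub>R (B *v d) + z) \<circ> (\<lambda>(u, z). (u, B *v z)) = (\<lambda>(u, z). B *v (u *\<^sub>R d + z))"
    by (auto simp: matrix_vector_right_distrib matrix_vector_mult_scaleR)
  finally show ?thesis ..
qed

lemma distr_MMN_standardize:
  fixes S B :: "real^'n::{finite,wellorder}^'n::{finite,wellorder}"
  assumes "invertible (omega_diag S)"
  shows "distr (MMN xi S d H) borel (\<lambda>y. (B ** matrix_inv (omega_diag S)) *v (y - xi))
    = distr (interval_measure H \<Otimes>\<^sub>M gaussian (Omega_bar S - outer d)) borel (\<lambda>(u, z). B *v (u *\<^sub>R d + z))"
proof -
  have "(B ** matrix_inv (omega_diag S)) *v (omega_diag S *v v) = B *v v" for v
    by (simp add: matrix_vector_mul_assoc matrix_mul_assoc[symmetric] matrix_inv_inverse[OF assms])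
  then show ?thesis
    unfolding MMN_def by (subst distr_distr) (simp_all add: comp_def case_prod_beta')
qed

theorem theorem5:
  fixes M :: "'a measure" and Y :: "'a \<Rightarrow> (real, 'p::{finite,wellorder}) vec"
    and xi d :: "(real, 'p::{finite,wellorder}) vec"
    and S :: "((real, 'p::{finite,wellorder}) vec, 'p::{finite,wellorder}) vec"
    and H :: "real \<Rightarrow> real"
  assumes "prob_space M"
    and "Y \<in> borel_measurable M"
    and "is_cdf H"
    and "sym_posdef S"
    and "sym_posdef (Omega_bar S - outer d)"
    and "distr M borel Y = MMN xi S d H"
  shows "\<exists>A :: ((real, 'p::{finite,wellorder}) vec, 'p::{finite,wellorder}) vec.
    distr M borel (\<lambda>x. A *v (Y x - xi)) =
      MMN 0 (mat 1) (axis (LEAST i. True) (sqrt (d \<bullet> (matrix_inv (Omega_bar S) *v d)))) H"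
proof -
  define e where "e = axis (LEAST i::'p. True) (sqrt (d \<bullet> (matrix_inv (Omega_bar S) *v d)))"
  have "sym_posdef (Omega_bar S)"
    using sym_posdef_add_outer[OF assms(5), of d] by simp
  then obtain B where B: "B ** Omega_bar S ** transpose B = mat 1" and "B *v d = e"
    using whitening e_def by blast
  have "invertible B"
    using B invertible_right_inverse by (metis matrix_mul_assoc)
  have cov: "B ** (Omega_bar S - outer d) ** transpose B = mat 1 - outer e"
    using B \<open>B *v d = e\<close> by (simp add: matrix_diff_ldistrib matrix_diff_rdistrib matrix_outer_transpose)
  define A where "A = B ** matrix_inv (omega_diag S)"
  have "distr M borel (\<lambda>x. A *v (Y x - xi)) = distr (MMN xi S d H) borel (\<lambda>y. A *v (y - xi))"
    unfolding assms(6)[symmetric] using assms(2) by (subst distr_distr) (simp_all add: comp_def)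
  also have "\<dots> = distr (interval_measure H \<Otimes>\<^sub>M gaussian (Omega_bar S - outer d)) borel
      (\<lambda>(u, z). B *v (u *\<^sub>R d + z))"
    unfolding A_def by (rule distr_MMN_standardize[OF invertible_omega_diag[OF assms(4)]])
  also have "\<dots> = distr (interval_measure H \<Otimes>\<^sub>M gaussian (mat 1 - outer e)) borel (\<lambda>(u, z). u *\<^sub>R e + z)"
    using distr_pair_gaussian_linear[OF sets_interval_measure assms(5) \<open>invertible B\<close>]
    by (simp add: cov \<open>B *v d = e\<close>)
  also have "\<dots> = MMN 0 (mat 1) e H"
    by (simp add: MMN_mat_1)
  finally show ?thesis
    unfolding e_def by blast
qed

end
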